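(* Let $p\ge1$ be an integer, $f\in C^p(\mathbb{R}^n;\mathbb{R}^n)$ with $f(0)=0$, and suppose $0\in\mathbb{R}^n$ is globally asymptotically stable and locally exponentially stable for $\dot z=f(z)$. Consider a consistent Runge–Kutta scheme of order $p$ for this system. Then Problem (P1) is solvable: there exists a continuous function $\varphi:\mathbb{R}^n\to(0,r]$ (for which the stage equations are uniquely solvable for all $h\in[0,\varphi(x)]$) such that $0$ is URGAS for the associated hybrid system (2.2).
   Context: A consistent $s$-stage Runge–Kutta scheme has coefficients $a_{ij},b_i$ with $\sum_ib_i=1$ and is represented by $F(h,x):=\sum_{i=1}^sb_if(Y_i)$ where $Y_i=x+h\sum_{j=1}^sa_{ij}f(Y_j)$, $i=1,\dots,s$; it is of order $p$ if $|z(h,x)-x-hF(h,x)|=O(h^{p+1})$ as $h\to0^+$, locally uniformly in $x$, where $z(t,x)$ is the exact solution with $z(0)=x$. The hybrid system (2.2): for each locally bounded $u:\mathbb{R}^+\to\mathbb{R}^+$ and $x_0$, $\tau_0=0$, $x(0)=x_0$, $h_i=\varphi(x(\tau_i))\exp(-u(\tau_i))$, $\tau_{i+1}=\tau_i+h_i$, $x(t)=x(\tau_i)+(t-\tau_i)F(h_i,x(\tau_i))$ on $[\tau_i,\tau_{i+1}]$; solution $x(t,x_0;u)$. URGAS: (a) for every $\varepsilon>0$ there is $\delta>0$ with $|x_0|<\delta\Rightarrow|x(t,x_0;u)|<\varepsilon$ for all $t\ge0$ and all $u$; (b) for every $R$, $\sup\{|x(t,x_0;u)|:t\ge0,|x_0|\le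 R,u\}<\infty$; (c) for all $\varepsilon,R$ there is $T$ with $|x(t,x_0;u)|\le\varepsilon$ for $t\ge T$, $|x_0|\le R$, all locally bounded $u\ge0$. Problem (P1) asks for existence of a continuous step bound $\varphi:\mathbb{R}^n\to(0,r]$, for some $r>0$, making the origin URGAS for (2.2).
   Formalization: "Uniquely solvable" is read as existence and uniqueness of the stage values continued continuously from h=0 (with F and order p defined through them), since outright uniqueness can fail: s=1, a=-1, b=1, f(z)=-z-z^3 has three stage solutions at x=0 for all 0<h<1. *)

theory Defs
  imports "HOL-Analysis.Analysis"
begin

text \<open>f is C^0 iff continuous; f is C^(k+1) iff f is (Frechet) differentiable everywhere
  and, for every direction v, the directional derivative x |-> Df(x) v is C^k.
  On finite-dimensional spaces this is the usual notion of C^k.\<close>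
fun Ck :: "nat \<Rightarrow> ('a::real_normed_vector \<Rightarrow> 'b::real_normed_vector) \<Rightarrow> bool" where
  "Ck 0 f = continuous_on UNIV f"
| "Ck (Suc k) f = ((\<forall>x. f differentiable (at x)) \<and>
                   (\<forall>v. Ck k (\<lambda>x. frechet_derivative f (at x) v)))"

definition is_sol :: "('a::real_normed_vector \<Rightarrow> 'a) \<Rightarrow> (real \<Rightarrow> 'a) \<Rightarrow> bool" where
  "is_sol f z \<longleftrightarrow> (\<forall>t\<ge>0. (z has_vector_derivative f (z t)) (at t within {0..}))"

definition GAS :: "('a::real_normed_vector \<Rightarrow> 'a) \<Rightarrow> bool" where
  "GAS f \<longleftrightarrow>
     (\<forall>x0. \<exists>z. is_sol f z \<and> z 0 = x0) \<and>
     (\<forall>\<epsilon>>0. \<exists>\<delta>>0. \<forall>z. is_sol f z \<and> norm (z 0) < \<delta> \<longrightarrow> (\<forall>t\<ge>0. norm (z t) < \<epsilon>)) \<and>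
     (\<forall>z. is_sol f z \<longrightarrow> (z \<longlongrightarrow> 0) at_top)"

definition LES :: "('a::real_normed_vector \<Rightarrow> 'a) \<Rightarrow> bool" where
  "LES f \<longleftrightarrow> (\<exists>\<delta>>0. \<exists>M. \<exists>c>0. \<forall>z. is_sol f z \<and> norm (z 0) < \<delta> \<longrightarrow>
       (\<forall>t\<ge>0. norm (z t) \<le> M * exp (- c * t) * norm (z 0)))"

definition exact_flow :: "('a::real_normed_vector \<Rightarrow> 'a) \<Rightarrow> real \<Rightarrow> 'a \<Rightarrow> 'a" where
  "exact_flow f t x = (THE y. \<exists>z. is_sol f z \<and> z 0 = x \<and> z t = y)"

definition RK_stages ::
  "(nat \<Rightarrow> nat \<Rightarrow> real) \<Rightarrow> nat \<Rightarrow> ('a::real_normed_vector \<Rightarrow> 'a) \<Rightarrow> real \<Rightarrow> 'a \<Rightarrow> (nat \<Rightarrow> 'a) \<Rightarrow> bool" where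
  "RK_stages a s f h x Y \<longleftrightarrow> (\<forall>i<s. Y i = x + h *\<^sub>R (\<Sum>j<s. a i j *\<^sub>R f (Y j)))"

text \<open>Stage values reachable by continuation from h = 0 (where the stages are Y_i = x):
  a branch continuous in the step size on [0,h] solving the stage equations.\<close>
definition RK_reach ::
  "(nat \<Rightarrow> nat \<Rightarrow> real) \<Rightarrow> nat \<Rightarrow> ('a::real_normed_vector \<Rightarrow> 'a) \<Rightarrow> real \<Rightarrow> 'a \<Rightarrow> (nat \<Rightarrow> 'a) \<Rightarrow> bool" where
  "RK_reach a s f h x Y \<longleftrightarrow>
     (\<exists>g :: real \<Rightarrow> nat \<Rightarrow> 'a.
        (\<forall>i<s. continuous_on {0..h} (\<lambda>t. g t i)) \<and>
        (\<forall>t\<in>{0..h}. RK_stages a s f t x (g t)) \<and>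
        (\<forall>i<s. g h i = Y i))"

definition RK_unique ::
  "(nat \<Rightarrow> nat \<Rightarrow> real) \<Rightarrow> nat \<Rightarrow> ('a::real_normed_vector \<Rightarrow> 'a) \<Rightarrow> real \<Rightarrow> 'a \<Rightarrow> bool" where
  "RK_unique a s f h x \<longleftrightarrow>
     (\<exists>Y. RK_reach a s f h x Y) \<and>
     (\<forall>Y Y'. RK_reach a s f h x Y \<and> RK_reach a s f h x Y' \<longrightarrow> (\<forall>i<s. Y i = Y' i))"

definition RK_F ::
  "(nat \<Rightarrow> nat \<Rightarrow> real) \<Rightarrow> (nat \<Rightarrow> real) \<Rightarrow> nat \<Rightarrow> ('a::real_normed_vector \<Rightarrow> 'a) \<Rightarrow> real \<Rightarrow> 'a \<Rightarrow> 'a" where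
  "RK_F a b s f h x = (\<Sum>i<s. b i *\<^sub>R f ((SOME Y. RK_reach a s f h x Y) i))"

definition RK_consistent :: "(nat \<Rightarrow> real) \<Rightarrow> nat \<Rightarrow> bool" where
  "RK_consistent b s \<longleftrightarrow> (\<Sum>i<s. b i) = 1"

definition RK_order ::
  "(nat \<Rightarrow> nat \<Rightarrow> real) \<Rightarrow> (nat \<Rightarrow> real) \<Rightarrow> nat \<Rightarrow> ('a::real_normed_vector \<Rightarrow> 'a) \<Rightarrow> nat \<Rightarrow> bool" where
  "RK_order a b s f p \<longleftrightarrow>
     (\<forall>K. compact K \<longrightarrow> (\<exists>C h1. h1 > 0 \<and>
        (\<forall>x\<in>K. \<forall>h. 0 < h \<and> h \<le> h1 \<longrightarrow>
            RK_unique a s f h x \<and>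
            norm (exact_flow f h x - x - h *\<^sub>R RK_F a b s f h x) \<le> C * h ^ (p + 1))))"

definition locally_bounded_nonneg :: "(real \<Rightarrow> real) \<Rightarrow> bool" where
  "locally_bounded_nonneg u \<longleftrightarrow> (\<forall>t\<ge>0. u t \<ge> 0) \<and> (\<forall>T. \<exists>B. \<forall>t\<in>{0..T}. u t \<le> B)"

fun hyb_seq :: "('a::real_normed_vector \<Rightarrow> real) \<Rightarrow> (real \<Rightarrow> 'a \<Rightarrow> 'a) \<Rightarrow> (real \<Rightarrow> real) \<Rightarrow> 'a \<Rightarrow> nat \<Rightarrow> real \<times> 'a" where
  "hyb_seq \<phi> F u x0 0 = (0, x0)"
| "hyb_seq \<phi> F u x0 (Suc i) =
     (let (\<tau>, x) = hyb_seq \<phi> F u x0 i; h = \<phi> x * exp (- u \<tau>) in (\<tau> + h, x + h *\<^sub>R F h x))"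

definition hyb_traj :: "('a::real_normed_vector \<Rightarrow> real) \<Rightarrow> (real \<Rightarrow> 'a \<Rightarrow> 'a) \<Rightarrow> (real \<Rightarrow> real) \<Rightarrow> 'a \<Rightarrow> real \<Rightarrow> 'a" where
  "hyb_traj \<phi> F u x0 t =
     (let i = (THE i. fst (hyb_seq \<phi> F u x0 i) \<le> t \<and> t < fst (hyb_seq \<phi> F u x0 (Suc i)));
          \<tau> = fst (hyb_seq \<phi> F u x0 i); x = snd (hyb_seq \<phi> F u x0 i);
          h = \<phi> x * exp (- u \<tau>)
      in x + (t - \<tau>) *\<^sub>R F h x)"

text \<open>URGAS of the origin; clause (0) says the trajectories are defined for all t >= 0.\<close>
definition URGAS :: "('a::real_normed_vector \<Rightarrow> real) \<Rightarrow> (real \<Rightarrow> 'a \<Rightarrow> 'a) \<Rightarrow> bool" where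
  "URGAS \<phi> F \<longleftrightarrow>
     (\<forall>x0 u. locally_bounded_nonneg u \<longrightarrow> (\<forall>t\<ge>0. \<exists>i. t < fst (hyb_seq \<phi> F u x0 i))) \<and>
     (\<forall>\<epsilon>>0. \<exists>\<delta>>0. \<forall>x0 u t. locally_bounded_nonneg u \<and> norm x0 < \<delta> \<and> t \<ge> 0 \<longrightarrow>
         norm (hyb_traj \<phi> F u x0 t) < \<epsilon>) \<and>
     (\<forall>R. \<exists>B. \<forall>x0 u t. locally_bounded_nonneg u \<and> norm x0 \<le> R \<and> t \<ge> 0 \<longrightarrow>
         norm (hyb_traj \<phi> F u x0 t) \<le> B) \<and>
     (\<forall>\<epsilon>>0. \<forall>R. \<exists>T. \<forall>x0 u t. locally_bounded_nonneg u \<and> norm x0 \<le> R \<and> t \<ge> T \<longrightarrow>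
         norm (hyb_traj \<phi> F u x0 t) \<le> \<epsilon>)"

end

theory Submission
  imports Defs
begin

text \<open>If \<open>2 * c\<close> is the local exponential decay rate and \<open>z(t, x)\<close> the exact flow, then
  \<open>V(x) = sup\<^sub>t e\<^bsup>c t\<^esup> |z(t, x)|\<close> is finite by attractivity, locally Lipschitz, bounded below by
  \<open>|x|\<close>, and satisfies \<open>V(z(t, x)) \<le> e\<^bsup>-c t\<^esup> V(x)\<close> on the whole space. Since \<open>f\<close> is locally Lipschitz with
  \<open>f(0) = 0\<close>, consistency of the scheme gives \<open>|z(\<sigma>, x) - x - \<sigma> F(h, x)| \<le> C \<sigma> h |x|\<close> locally for
  \<open>0 \<le> \<sigma> \<le> h\<close>. As \<open>|x| \<le> V(x)\<close>, the error is relative to \<open>V\<close> and for small \<open>h\<close> is absorbed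
  by half of the decay, uniformly near every point including the origin; hence \<open>V\<close> decreases
  along the hybrid system for every sufficiently small continuous step bound.\<close>

section \<open>Lipschitz bounds for smooth maps, bootstrapping and the mean value inequality\<close>

lemma Ck_imp_continuous: "Ck k g \<Longrightarrow> continuous_on UNIV g"
  by (cases k) (auto intro!: differentiable_imp_continuous_on simp: differentiable_on_def
      intro: differentiable_at_withinI)

text \<open>The derivatives in the basis directions are continuous, hence bounded on the compact
  ball. Their bounds add up to a bound on the operator norm, and the mean value inequality applies
  because the ball is convex.\<close>

lemma Ck_imp_lipschitz_on_cball:
  fixes f :: "'a::euclidean_space \<Rightarrow> 'b::real_normed_vector"
  assumes "Ck p f" "p \<ge> 1"
  obtains L where "L-lipschitz_on (cball 0 R) f"
proof -
  obtain k where p: "p = Suc k"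
    using assms(2) by (cases p) auto
  let ?D = "\<lambda>x. frechet_derivative f (at x)"
  have diff: "(f has_derivative ?D x) (at x within cball 0 R)" for x
    using assms(1) unfolding p by (simp add: frechet_derivative_works has_derivative_at_withinI)
  have lin: "linear (?D x)" for x
    using assms(1) unfolding p by (simp add: linear_frechet_derivative)
  have "\<exists>B. \<forall>x\<in>cball 0 R. norm (?D x i) \<le> B" for i
  proof -
    have "continuous_on (cball 0 R) (\<lambda>x. ?D x i)"
      using assms(1) Ck_imp_continuous[of k "\<lambda>x. ?D x i"] unfolding p
      by (auto intro: continuous_on_subset)
    then have "bounded ((\<lambda>x. ?D x i) ` cball 0 R)"
      using compact_cball compact_continuous_image compact_imp_bounded by blast
    then show ?thesis
      by (auto simp: bounded_iff)
  qed
  then obtain B where B: "\<And>i x. x \<in> cball 0 R \<Longrightarrow> norm (?D x i) \<le> B i"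
    by metis
  define L where "L = max 0 (\<Sum>i\<in>Basis. B i)"
  have "onorm (?D x) \<le> L" if "x \<in> cball 0 R" for x
  proof (rule onorm_le)
    fix v
    have "?D x v = ?D x (\<Sum>i\<in>Basis. (v \<bullet> i) *\<^sub>R i)"
      by (simp add: euclidean_representation)
    then have "norm (?D x v) = norm (\<Sum>i\<in>Basis. (v \<bullet> i) *\<^sub>R ?D x i)"
      by (simp only: linear_sum[OF lin] linear_cmul[OF lin])
    also have "\<dots> \<le> (\<Sum>i\<in>Basis. B i * norm v)"
    proof (rule order_trans[OF norm_sum sum_mono])
      fix i :: 'a assume "i \<in> Basis"
      then show "norm ((v \<bullet> i) *\<^sub>R ?D x i) \<le> B i * norm v"
        using mult_mono[OF Basis_le_norm B[OF that]] by (simp add: mult.commute)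
    qed
    also have "\<dots> \<le> L * norm v"
      by (simp add: L_def sum_distrib_right[symmetric] mult_right_mono)
    finally show "norm (?D x v) \<le> L * norm v" .
  qed
  then have "L-lipschitz_on (cball 0 R) f"
    using differentiable_bound[OF convex_cball diff]
    by (intro lipschitz_onI) (auto simp: dist_norm L_def)
  then show thesis by (rule that)
qed

text \<open>Bootstrap principle: at the first time where \<open>d\<close> reaches \<open>c\<close>,
  the weak bound holds up to that time, so \<open>step\<close> would make \<open>d\<close> strictly
  smaller there. It yields a priori bounds for solutions and for Runge-Kutta stages.\<close>

lemma continuation_bound:
  fixes d :: "real \<Rightarrow> real"
  assumes cont: "continuous_on {0..T} d" and "d 0 < c"
    and step: "\<And>t. 0 \<le> t \<Longrightarrow> t \<le> T \<Longrightarrow> (\<And>s. 0 \<le> s \<Longrightarrow> s \<le> t \<Longrightarrow> d s \<le> c) \<Longrightarrow> d t < c"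
    and t: "0 \<le> t" "t \<le> T"
  shows "d t < c"
proof (rule ccontr)
  assume "\<not> d t < c"
  define S where "S = {s \<in> {0..T}. c \<le> d s}"
  have "closed S"
    unfolding S_def by (intro continuous_closed_preimage_constant continuous_on_closed_Collect_le
      continuous_on_const cont closed_atLeastAtMost)
  then have "compact S"
    by (auto simp: compact_eq_bounded_closed S_def intro: bounded_subset[OF bounded_closed_interval])
  moreover have "t \<in> S"
    using \<open>\<not> d t < c\<close> t by (auto simp: S_def)
  ultimately obtain s where s: "s \<in> S" "\<And>r. r \<in> S \<Longrightarrow> s \<le> r"
    using compact_attains_inf[of S] by blast
  \<comment> \<open>The intermediate value theorem gives a time in \<open>S\<close> no later than
    the minimum \<open>s\<close>; it must be \<open>s\<close> itself, so the value there is exactly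
    \<open>c\<close>.\<close>
  have "\<exists>r\<ge>0. r \<le> s \<and> d r = c"
    using s(1) \<open>d 0 < c\<close> continuous_on_subset[OF cont]
    by (intro IVT') (auto simp: S_def)
  then have "d s = c"
    using s by (fastforce simp: S_def)
  moreover have "d r \<le> c" if "0 \<le> r" "r \<le> s" for r
    using s that \<open>d s = c\<close> by (fastforce simp: S_def)
  ultimately show False
    using step[of s] s(1) by (auto simp: S_def)
qed

lemma vector_differentiable_bound:
  fixes z :: "real \<Rightarrow> 'a::real_normed_vector"
  assumes "convex S" "\<And>t. t \<in> S \<Longrightarrow> (z has_vector_derivative z' t) (at t within S)"
    and "\<And>t. t \<in> S \<Longrightarrow> norm (z' t) \<le> B" and "s \<in> S" "t \<in> S"
  shows "norm (z t - z s) \<le> B * norm (t - s)"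
proof (rule differentiable_bound[OF assms(1)])
  show "(z has_derivative (\<lambda>h. h *\<^sub>R z' r)) (at r within S)" if "r \<in> S" for r
    using assms(2)[OF that] by (simp add: has_vector_derivative_def)
  show "onorm (\<lambda>h. h *\<^sub>R z' r) \<le> B" if "r \<in> S" for r
    using assms(3)[OF that] by (intro onorm_le) (simp add: mult.commute[of B] mult_left_mono)
qed (use assms in auto)

section \<open>Solutions on the half-line and their dependence on initial values\<close>

lemma is_sol_has_vector_derivative_within:
  "is_sol f z \<Longrightarrow> 0 \<le> t \<Longrightarrow> S \<subseteq> {0..} \<Longrightarrow> (z has_vector_derivative f (z t)) (at t within S)"
  unfolding is_sol_def by (blast intro: has_vector_derivative_within_subset)

lemma is_sol_has_vector_derivative:
  assumes "is_sol f z" "0 < t"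
  shows "(z has_vector_derivative f (z t)) (at t)"
proof -
  have "at t within {0..} = at t"
    using assms(2) by (intro at_within_interior) (simp add: interior_Ici[of _ "-1"])
  then show ?thesis
    using assms unfolding is_sol_def by (metis less_imp_le)
qed

lemma is_sol_continuous: "is_sol f z \<Longrightarrow> continuous_on {0..} z"
  unfolding is_sol_def continuous_on_eq_continuous_within
  by (auto intro: has_vector_derivative_continuous)

lemma is_sol_shift:
  assumes "is_sol f z" "0 \<le> s"
  shows "is_sol f (\<lambda>t. z (s + t))"
  unfolding is_sol_def
proof (intro allI impI)
  fix t :: real assume "0 \<le> t"
  have "((z \<circ> (+) s) has_vector_derivative 1 *\<^sub>R f (z (s + t))) (at t within {0..})"
  proof (rule vector_diff_chain_within)
    show "((+) s has_vector_derivative 1) (at t within {0..})"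
      by (auto intro!: derivative_eq_intros)
    show "(z has_vector_derivative f (z (s + t))) (at (s + t) within (+) s ` {0..})"
      using assms \<open>0 \<le> t\<close> by (intro is_sol_has_vector_derivative_within) auto
  qed
  then show "((\<lambda>t. z (s + t)) has_vector_derivative f (z (s + t))) (at t within {0..})"
    by (simp add: o_def)
qed

text \<open>Gronwall's inequality. The squared distance is used because it stays differentiable
  where the two solutions meet; damped by exp(-2 L t) it is nonincreasing.\<close>

lemma is_sol_dist_le:
  fixes f :: "'a::real_inner \<Rightarrow> 'a"
  assumes z: "is_sol f z" and w: "is_sol f w"
    and L: "L-lipschitz_on (cball 0 R) f" and "0 \<le> T"
    and zR: "\<And>t. 0 \<le> t \<Longrightarrow> t \<le> T \<Longrightarrow> norm (z t) \<le> R"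
    and wR: "\<And>t. 0 \<le> t \<Longrightarrow> t \<le> T \<Longrightarrow> norm (w t) \<le> R"
  shows "norm (z T - w T) \<le> exp (L * T) * norm (z 0 - w 0)"
proof -
  define E where "E t = ((z t - w t) \<bullet> (z t - w t)) * exp (- 2 * L * t)" for t
  have "E T \<le> E 0"
  proof (rule DERIV_nonpos_imp_decreasing_open[OF \<open>0 \<le> T\<close>])
    fix t assume t: "0 < t" "t < T"
    let ?d = "z t - w t" and ?e = "f (z t) - f (w t)"
    have d: "((\<lambda>t. z t - w t) has_derivative (\<lambda>h. h *\<^sub>R ?e)) (at t)"
      using has_vector_derivative_diff[OF is_sol_has_vector_derivative[OF z t(1)]
        is_sol_has_vector_derivative[OF w t(1)]] by (simp add: has_vector_derivative_def)
    have "(E has_derivative (\<lambda>h. 2 * (?d \<bullet> ?e - L * (?d \<bullet> ?d)) * exp (- 2 * L * t) * h)) (at t)"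
      unfolding E_def
      by (rule derivative_eq_intros d refl)+ (auto simp: fun_eq_iff inner_commute algebra_simps)
    then have D: "(E has_real_derivative 2 * (?d \<bullet> ?e - L * (?d \<bullet> ?d)) * exp (- 2 * L * t)) (at t)"
      by (rule has_derivative_imp_has_field_derivative) simp
    have "?d \<bullet> ?e \<le> L * (?d \<bullet> ?d)"
    proof -
      have "?d \<bullet> ?e \<le> norm ?d * norm ?e"
        by (rule norm_cauchy_schwarz)
      also have "norm ?e \<le> L * norm ?d"
        using lipschitz_onD[OF L, of "z t" "w t"] zR[of t] wR[of t] t by (simp add: dist_norm)
      finally show ?thesis
        by (simp add: mult_left_mono dot_square_norm power2_eq_square mult.left_commute)
    qed
    then have "2 * (?d \<bullet> ?e - L * (?d \<bullet> ?d)) * exp (- 2 * L * t) \<le> 0"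
      by - (rule mult_nonpos_nonneg, simp_all)
    with D show "\<exists>y. (E has_real_derivative y) (at t) \<and> y \<le> 0"
      by blast
  next
    show "continuous_on {0..T} E"
      unfolding E_def
      by (intro continuous_intros continuous_on_subset[OF is_sol_continuous[OF z]]
        continuous_on_subset[OF is_sol_continuous[OF w]]) auto
  qed
  then have "(norm (z T - w T))\<^sup>2 * exp (- 2 * L * T) \<le> (norm (z 0 - w 0))\<^sup>2"
    by (simp add: E_def power2_norm_eq_inner)
  then have "(norm (z T - w T))\<^sup>2 \<le> exp (2 * L * T) * (norm (z 0 - w 0))\<^sup>2"
    by (simp add: exp_minus field_simps)
  also have "\<dots> = (exp (L * T) * norm (z 0 - w 0))\<^sup>2"
    by (simp add: power_mult_distrib exp_double[symmetric] mult.assoc)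
  finally show ?thesis
    by (rule power2_le_imp_le) simp
qed

lemma is_sol_bounded:
  assumes "is_sol f z"
  obtains B where "\<And>t. 0 \<le> t \<Longrightarrow> t \<le> T \<Longrightarrow> norm (z t) \<le> B"
proof -
  have "compact (z ` {0..T})"
    by (intro compact_continuous_image continuous_on_subset[OF is_sol_continuous[OF assms]]) auto
  then obtain B where "\<forall>x\<in>z ` {0..T}. norm x \<le> B"
    using compact_imp_bounded bounded_iff by metis
  then show thesis by (intro that) auto
qed

section \<open>Flows of locally Lipschitz vector fields\<close>

text \<open>Only existence of forward solutions is assumed; uniqueness follows from the Lipschitz
  bounds by Gronwall's inequality.\<close>

locale complete_field =
  fixes f :: "'a::euclidean_space \<Rightarrow> 'a"
  assumes lipschitz: "\<And>R. \<exists>L. L-lipschitz_on (cball 0 R) f"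
    and f_0: "f 0 = 0"
    and ex_sol: "\<And>x. \<exists>z. is_sol f z \<and> z 0 = x"
begin

definition flow :: "'a \<Rightarrow> real \<Rightarrow> 'a" where
  "flow x = (SOME z. is_sol f z \<and> z 0 = x)"

lemma is_sol_flow: "is_sol f (flow x)"
  and flow_at_0 [simp]: "flow x 0 = x"
  using someI_ex[OF ex_sol[of x]] by (simp_all add: flow_def)

text \<open>On the compact interval from 0 to \<open>t\<close> both solutions lie in a common ball,
  so Gronwall's inequality applies with initial distance 0.\<close>

lemma flow_unique:
  assumes z: "is_sol f z" and "0 \<le> t"
  shows "z t = flow (z 0) t"
proof -
  obtain B1 where B1: "\<And>s. 0 \<le> s \<Longrightarrow> s \<le> t \<Longrightarrow> norm (z s) \<le> B1"
    using is_sol_bounded[OF z, of t] by blast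
  obtain B2 where B2: "\<And>s. 0 \<le> s \<Longrightarrow> s \<le> t \<Longrightarrow> norm (flow (z 0) s) \<le> B2"
    using is_sol_bounded[OF is_sol_flow, of t "z 0"] by blast
  obtain L where "L-lipschitz_on (cball 0 (max B1 B2)) f"
    using lipschitz by blast
  from is_sol_dist_le[OF z is_sol_flow this \<open>0 \<le> t\<close>, of "z 0"] show ?thesis
    using B1 B2 by (simp add: max.coboundedI1 max.coboundedI2)
qed

lemma flow_add: "0 \<le> s \<Longrightarrow> 0 \<le> t \<Longrightarrow> flow (flow x s) t = flow x (s + t)"
  using flow_unique[OF is_sol_shift[OF is_sol_flow]] by simp

lemma flow_zero: "0 \<le> t \<Longrightarrow> flow 0 t = 0"
  using flow_unique[of "\<lambda>_. 0" t] by (simp add: is_sol_def f_0)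

text \<open>While a solution stays within 1 of the orbit of \<open>x0\<close>, it lies in
  \<open>cball 0 B\<close> and Gronwall's inequality holds with the constant \<open>L\<close>;
  \<open>continuation_bound\<close> shows that it never leaves this tube before time
  \<open>T\<close>.\<close>

lemma flow_lipschitz_near:
  assumes "0 \<le> T"
  obtains e B L where "0 < e" "0 \<le> L" "L-lipschitz_on (cball 0 B) f" "norm x0 < B"
    "\<And>x t. dist x x0 < e \<Longrightarrow> 0 \<le> t \<Longrightarrow> t \<le> T \<Longrightarrow> norm (flow x t) \<le> B"
    "\<And>x y t. dist x x0 < e \<Longrightarrow> dist y x0 < e \<Longrightarrow> 0 \<le> t \<Longrightarrow> t \<le> T \<Longrightarrow>
       dist (flow x t) (flow y t) \<le> exp (L * t) * dist x y"
proof -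
  obtain B0 where B0: "\<And>t. 0 \<le> t \<Longrightarrow> t \<le> T \<Longrightarrow> norm (flow x0 t) \<le> B0"
    using is_sol_bounded[OF is_sol_flow, of T x0] by blast
  define B where "B = B0 + 1"
  obtain L where L: "L-lipschitz_on (cball 0 B) f"
    using lipschitz by blast
  then have "0 \<le> L"
    by (rule lipschitz_on_nonneg)
  \<comment> \<open>Growth by the factor exp(L T) keeps deviations that start below \<open>e\<close>
    strictly below 1 up to time \<open>T\<close>.\<close>
  define e where "e = exp (- (L * T))"
  have flow_le: "norm (flow x t) \<le> B" if x: "dist x x0 < e" and t: "0 \<le> t" "t \<le> T" for x t
  proof -
    have "norm (flow x t - flow x0 t) < 1"
    proof (rule continuation_bound[where T = T and t = t])
      show "continuous_on {0..T} (\<lambda>t. norm (flow x t - flow x0 t))"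
        by (intro continuous_intros continuous_on_subset[OF is_sol_continuous[OF is_sol_flow]]) auto
      have "e \<le> 1"
        using \<open>0 \<le> L\<close> assms by (simp add: e_def)
      then show "norm (flow x 0 - flow x0 0) < 1"
        using x by (simp add: dist_norm)
      fix t assume t: "0 \<le> t" "t \<le> T"
        and le: "\<And>s. 0 \<le> s \<Longrightarrow> s \<le> t \<Longrightarrow> norm (flow x s - flow x0 s) \<le> 1"
      have "norm (flow x s) \<le> B" if "0 \<le> s" "s \<le> t" for s
        using le[OF that] B0[of s] that t norm_triangle_sub[of "flow x s" "flow x0 s"]
        by (simp add: B_def)
      moreover have "norm (flow x0 s) \<le> B" if "0 \<le> s" "s \<le> t" for s
        using B0[of s] that t by (simp add: B_def)
      ultimately have "norm (flow x t - flow x0 t) \<le> exp (L * t) * dist x x0"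
        using is_sol_dist_le[OF is_sol_flow is_sol_flow L t(1), of x x0] by (simp add: dist_norm)
      also have "\<dots> \<le> exp (L * T) * dist x x0"
        using t \<open>0 \<le> L\<close> by (simp add: mult_left_mono mult_right_mono)
      also have "\<dots> < exp (L * T) * e"
        using x by simp
      finally show "norm (flow x t - flow x0 t) < 1"
        by (simp add: e_def exp_minus)
    qed (use t in auto)
    then show ?thesis
      using B0[of t] t norm_triangle_sub[of "flow x t" "flow x0 t"] by (simp add: B_def)
  qed
  show thesis
  proof (rule that[of e L B])
    show "norm x0 < B"
      using B0[of 0] assms by (simp add: B_def)
    show "dist (flow x t) (flow y t) \<le> exp (L * t) * dist x y"
      if "dist x x0 < e" "dist y x0 < e" "0 \<le> t" "t \<le> T" for x y t
      using is_sol_dist_le[OF is_sol_flow is_sol_flow L that(3), of x y] that flow_le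
      by (simp add: dist_norm)
  qed (use \<open>0 \<le> L\<close> L flow_le in \<open>auto simp: e_def\<close>)
qed

text \<open>Comparison with the zero solution makes both bounds proportional to
  \<open>norm x\<close>, which is what later allows the error to be absorbed at the origin. Bounding
  the velocity gives first order in \<open>t\<close>, bounding its variation gives second
  order.\<close>

lemma flow_euler_error:
  obtains e C where "0 < e" "0 \<le> C"
    "\<And>x t. dist x x0 < e \<Longrightarrow> 0 \<le> t \<Longrightarrow> t \<le> 1 \<Longrightarrow>
       norm (flow x t - x - t *\<^sub>R f x) \<le> C * t^2 * norm x"
    "\<And>x t. dist x x0 < e \<Longrightarrow> 0 \<le> t \<Longrightarrow> t \<le> 1 \<Longrightarrow> norm (flow x t - x) \<le> C * t * norm x"
proof -
  obtain e B L where e: "0 < e" "0 \<le> L" and L: "L-lipschitz_on (cball 0 B) f"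
    and B: "norm x0 < B" "\<And>x t. dist x x0 < e \<Longrightarrow> 0 \<le> t \<Longrightarrow> t \<le> 1 \<Longrightarrow> norm (flow x t) \<le> B"
    using flow_lipschitz_near[of 1 x0] by (metis zero_le_one)
  have "0 \<le> B"
    using B(1) norm_ge_zero[of x0] by linarith
  have deriv: "(flow x has_vector_derivative f (flow x r)) (at r within {0..t})" if "0 \<le> r" for r t x
    using that by (intro is_sol_has_vector_derivative_within is_sol_flow) auto
  define C1 where "C1 = L * exp L"
  have "0 \<le> C1"
    using e by (simp add: C1_def)
  have first: "norm (flow x t - x) \<le> C1 * t * norm x"
    if x: "dist x x0 < e" and t: "0 \<le> t" "t \<le> 1" for x t
  proof -
    have "norm (flow x t - flow x 0) \<le> (C1 * norm x) * norm (t - 0)"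
    proof (rule vector_differentiable_bound)
      show "convex {0..t}" "0 \<in> {0..t}" "t \<in> {0..t}"
        using t by auto
      fix r assume r: "r \<in> {0..t}"
      have "norm (flow x r - 0) \<le> exp (L * r) * norm (x - 0)"
        using is_sol_dist_le[OF is_sol_flow is_sol_flow[of 0] L, of r x] r t B(2)[OF x]
        by (simp add: flow_zero \<open>0 \<le> B\<close>)
      also have "\<dots> \<le> exp L * norm x"
        using r t e by (auto intro!: mult_right_mono mult_left_le)
      finally have "norm (flow x r) \<le> exp L * norm x" by simp
      moreover have "norm (f (flow x r)) \<le> L * norm (flow x r)"
        using lipschitz_onD[OF L, of "flow x r" 0] B(2)[OF x, of r] r t \<open>0 \<le> B\<close>
        by (simp add: f_0 dist_norm)
      ultimately show "norm (f (flow x r)) \<le> C1 * norm x"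
        using mult_left_mono[OF _ e(2)] unfolding C1_def by (metis mult.assoc order_trans)
    qed (use deriv in auto)
    then show ?thesis
      using t by (simp add: mult_ac)
  qed
  define C where "C = max C1 (L * C1)"
  show thesis
  proof (rule that[of e C])
    show "0 < e" "0 \<le> C"
      using e \<open>0 \<le> C1\<close> by (auto simp: C_def)
  next
    fix x t assume x: "dist x x0 < e" and t: "0 \<le> t" "t \<le> (1::real)"
    have "C1 * t * norm x \<le> C * t * norm x"
      using t by (intro mult_right_mono) (auto simp: C_def)
    then show "norm (flow x t - x) \<le> C * t * norm x"
      using first[OF x t] by linarith
    \<comment> \<open>The derivative of \<open>?w\<close> is \<open>f (flow x r) - f x\<close>,
      which the first-order estimate already controls.\<close>
    let ?w = "\<lambda>r. flow x r - r *\<^sub>R f x"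
    have "norm (?w t - ?w 0) \<le> (L * (C1 * t * norm x)) * norm (t - 0)"
    proof (rule vector_differentiable_bound)
      show "convex {0..t}" "0 \<in> {0..t}" "t \<in> {0..t}"
        using t by auto
      fix r assume r: "r \<in> {0..t}"
      show "(?w has_vector_derivative f (flow x r) - f x) (at r within {0..t})"
        using r deriv by (auto intro!: derivative_eq_intros)
      have "norm (f (flow x r) - f x) \<le> L * norm (flow x r - x)"
        using lipschitz_onD[OF L, of "flow x r" x] B(2)[OF x, of r] B(2)[OF x, of 0] r t
        by (simp add: dist_norm)
      also have "\<dots> \<le> L * (C1 * r * norm x)"
        using first[OF x, of r] r t e by (intro mult_left_mono) auto
      also have "\<dots> \<le> L * (C1 * t * norm x)"
        using r \<open>0 \<le> C1\<close> e by (intro mult_left_mono mult_right_mono) auto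
      finally show "norm (f (flow x r) - f x) \<le> L * (C1 * t * norm x)" .
    qed
    then have "norm (flow x t - x - t *\<^sub>R f x) \<le> L * C1 * (t^2 * norm x)"
      using t by (simp add: algebra_simps power2_eq_square)
    also have "\<dots> \<le> C * (t^2 * norm x)"
      by (intro mult_right_mono) (auto simp: C_def)
    finally show "norm (flow x t - x - t *\<^sub>R f x) \<le> C * t^2 * norm x"
      by (simp add: mult.assoc)
  qed
qed

end

section \<open>Step bounds and Lyapunov functions for the hybrid system\<close>

text \<open>Distance to a set is continuous, so half the distance from \<open>(x, 0)\<close> to the
  set of bad pairs is a continuous step bound. The local hypothesis keeps it positive.\<close>

lemma continuous_step_bound:
  fixes P :: "'a::real_normed_vector \<Rightarrow> real \<Rightarrow> bool"
  assumes P: "\<And>x. \<exists>e>0. \<forall>y h. dist y x < e \<and> 0 < h \<and> h < e \<longrightarrow> P y h"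
  obtains \<phi> where "continuous_on UNIV \<phi>" "\<And>x. 0 < \<phi> x" "\<And>x. \<phi> x \<le> (1::real)"
    "\<And>x h. 0 < h \<Longrightarrow> h \<le> \<phi> x \<Longrightarrow> P x h"
proof
  \<comment> \<open>The pairs with \<open>1 \<le> h\<close> keep \<open>B\<close> nonempty; \<open>infdist\<close> to the empty set would be 0.\<close>
  define B where "B = {(y, h). 0 < h \<and> (1 \<le> h \<or> \<not> P y h)}"
  define \<phi> where "\<phi> x = infdist (x, 0) B / 2" for x
  have B1: "(x, 1) \<in> B" for x
    by (simp add: B_def)
  show "continuous_on UNIV \<phi>"
    unfolding \<phi>_def by (intro continuous_intros) auto
  have le: "infdist (x, 0) B \<le> h" if "(x, h) \<in> B" for x h
    using infdist_le[OF that, of "(x, 0)"] that by (simp add: dist_Pair_Pair B_def)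
  show "\<phi> x \<le> 1" for x
    using le[OF B1[of x]] by (simp add: \<phi>_def)
  show pos: "0 < \<phi> x" for x
  proof -
    obtain e where e: "0 < e" "\<And>y h. dist y x < e \<Longrightarrow> 0 < h \<Longrightarrow> h < e \<Longrightarrow> P y h"
      using P[of x] by blast
    \<comment> \<open>Both coordinate distances are at most the product distance, so a bad pair
      closer than \<open>min e 1\<close> would fall under the local hypothesis.\<close>
    have "min e 1 \<le> dist (x, 0) p" if "p \<in> B" for p
    proof -
      obtain y h where p: "p = (y, h)" by (cases p)
      have "dist x y \<le> dist (x, 0) p" "\<bar>h\<bar> \<le> dist (x, 0) p"
        using dist_fst_le[of "(x, 0)" p] dist_snd_le[of "(x, 0)" p] by (simp_all add: p)
      then show ?thesis
        using that e(2)[of y h] by (force simp: B_def p dist_commute)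
    qed
    then have "min e 1 \<le> infdist (x, 0) B"
      using B1 by (subst infdist_notempty) (auto intro: cINF_greatest)
    then show ?thesis
      using e(1) by (auto simp: \<phi>_def min_def split: if_splits)
  qed
  show "P x h" if "0 < h" "h \<le> \<phi> x" for x h
  proof (rule ccontr)
    assume "\<not> P x h"
    then have "infdist (x, 0) B \<le> h"
      using that by (intro le) (simp add: B_def)
    then show False
      using that pos[of x] by (simp add: \<phi>_def)
  qed
qed

text \<open>\<open>V_step\<close> covers every partial step \<sigma> with the slope frozen at
  \<open>F h x\<close>, because the trajectory is affine between grid points.\<close>

locale hybrid_lyapunov =
  fixes \<phi> V :: "'a::euclidean_space \<Rightarrow> real" and F :: "real \<Rightarrow> 'a \<Rightarrow> 'a" and c :: real
  assumes cont_phi: "continuous_on UNIV \<phi>" and phi_pos: "\<And>x. 0 < \<phi> x" and phi_le: "\<And>x. \<phi> x \<le> 1"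
    and cont_V: "continuous_on UNIV V" and V_0: "V 0 = 0" and norm_le_V: "\<And>x. norm x \<le> V x"
    and c_pos: "0 < c"
    and V_step: "\<And>x h \<sigma>. 0 < h \<Longrightarrow> h \<le> \<phi> x \<Longrightarrow> 0 \<le> \<sigma> \<Longrightarrow> \<sigma> \<le> h \<Longrightarrow>
      V (x + \<sigma> *\<^sub>R F h x) \<le> (1 - c * \<sigma>) * V x"
begin

lemma V_nonneg: "0 \<le> V x"
  using norm_le_V[of x] norm_ge_zero[of x] by linarith

lemma V_step_le:
  assumes "0 < h" "h \<le> \<phi> x" "0 \<le> \<sigma>" "\<sigma> \<le> h"
  shows "V (x + \<sigma> *\<^sub>R F h x) \<le> V x"
proof -
  have "0 \<le> c * \<sigma> * V x"
    using V_nonneg[of x] assms c_pos by simp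
  then show ?thesis
    using V_step[OF assms] by (simp add: left_diff_distrib)
qed

context
  fixes u :: "real \<Rightarrow> real" and x0 :: 'a
  assumes u: "locally_bounded_nonneg u"
begin

abbreviation "\<tau> i \<equiv> fst (hyb_seq \<phi> F u x0 i)"
abbreviation "X i \<equiv> snd (hyb_seq \<phi> F u x0 i)"
abbreviation "h i \<equiv> \<phi> (X i) * exp (- u (\<tau> i))"

lemma \<tau>_Suc: "\<tau> (Suc i) = \<tau> i + h i"
  and X_Suc: "X (Suc i) = X i + h i *\<^sub>R F (h i) (X i)"
  by (simp_all add: Let_def split: prod.splits)

declare hyb_seq.simps(2) [simp del]

lemma h_pos: "0 < h i"
  by (simp add: phi_pos)

lemma \<tau>_mono: "i \<le> j \<Longrightarrow> \<tau> i \<le> \<tau> j"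
  by (rule lift_Suc_mono_le[of \<tau>]) (use h_pos in \<open>auto simp: \<tau>_Suc less_imp_le\<close>)

lemma \<tau>_nonneg: "0 \<le> \<tau> i"
  using \<tau>_mono[of 0 i] by simp

lemma h_le: "h i \<le> \<phi> (X i)"
  using u \<tau>_nonneg[of i] phi_pos[of "X i"] by (auto simp: locally_bounded_nonneg_def)

lemma V_X_le: "V (X i) \<le> V x0"
proof (induction i)
  case (Suc i)
  then show ?case
    using V_step_le[OF h_pos h_le less_imp_le[OF h_pos] order_refl, of i] by (simp add: X_Suc)
qed simp

text \<open>If the grid times stayed below \<open>t\<close>, then \<open>u\<close> would be bounded
  at all of them, and \<phi> has a positive minimum on the ball of radius \<open>V x0\<close>
  containing all states. The steps would be bounded away from 0, forcing the times to
  infinity.\<close>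

lemma \<tau>_unbounded: "\<exists>i. t < \<tau> i"
proof (rule ccontr)
  assume "\<not> ?thesis"
  then have le: "\<tau> i \<le> t" for i
    by (simp add: not_less)
  obtain B where B: "\<And>r. 0 \<le> r \<Longrightarrow> r \<le> t \<Longrightarrow> u r \<le> B"
    using u unfolding locally_bounded_nonneg_def by (metis atLeastAtMost_iff)
  have "\<exists>y\<in>cball 0 (V x0). \<forall>x\<in>cball 0 (V x0). \<phi> y \<le> \<phi> x"
    using V_nonneg[of x0] by (intro continuous_attains_inf continuous_on_subset[OF cont_phi]) auto
  then obtain m where m: "0 < m" "\<And>x. norm x \<le> V x0 \<Longrightarrow> m \<le> \<phi> x"
    using phi_pos by (metis mem_cball_0)
  have h: "m * exp (- B) \<le> h i" for i
    using m(1) m(2)[of "X i"] order_trans[OF norm_le_V V_X_le] B[OF \<tau>_nonneg le]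
    by (intro mult_mono) auto
  have "real i * (m * exp (- B)) \<le> \<tau> i" for i
  proof (induction i)
    case (Suc i)
    then show ?case
      using h[of i] by (simp add: \<tau>_Suc algebra_simps)
  qed simp
  moreover obtain i where "t < real i * (m * exp (- B))"
    using reals_Archimedean3[of "m * exp (- B)"] m(1) by auto
  ultimately show False
    using le[of i] by (meson not_less order_trans)
qed

lemma hyb_traj_in_step:
  assumes "0 \<le> t"
  obtains i where "\<tau> i \<le> t" "t < \<tau> (Suc i)"
    "hyb_traj \<phi> F u x0 t = X i + (t - \<tau> i) *\<^sub>R F (h i) (X i)"
proof -
  \<comment> \<open>Minimality yields \<open>\<tau> i \<le> t\<close>, with \<open>t \<ge> 0\<close>
    covering the case \<open>i = 0\<close>. Monotonicity of \<tau> then makes the index unique, as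
    the \<open>THE\<close> in \<open>hyb_traj\<close> requires.\<close>
  define i where "i = (LEAST i. t < \<tau> (Suc i))"
  obtain j where "t < \<tau> j"
    using \<tau>_unbounded by blast
  moreover have "\<tau> j \<le> \<tau> (Suc j)"
    by (rule \<tau>_mono) simp
  ultimately have "t < \<tau> (Suc j)"
    by linarith
  then have lt: "t < \<tau> (Suc i)"
    unfolding i_def by (rule LeastI[of "\<lambda>i. t < \<tau> (Suc i)"])
  have ge: "\<tau> i \<le> t"
  proof (cases i)
    case (Suc k)
    then show ?thesis
      using not_less_Least[of k "\<lambda>i. t < \<tau> (Suc i)"] by (simp add: i_def[symmetric])
  qed (use assms in simp)
  have "(THE i. \<tau> i \<le> t \<and> t < \<tau> (Suc i)) = i"
  proof (rule the_equality)
    fix k assume k: "\<tau> k \<le> t \<and> t < \<tau> (Suc k)"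
    show "k = i"
      using k lt ge \<tau>_mono[of "Suc k" i] \<tau>_mono[of "Suc i" k] by (cases k i rule: linorder_cases) auto
  qed (use lt ge in simp)
  then show thesis
    using lt ge by (intro that[of i]) (simp_all add: hyb_traj_def Let_def)
qed

lemma V_hyb_traj_le:
  assumes "0 \<le> t"
  obtains i where "\<tau> i \<le> t" "t < \<tau> i + 1" "V (hyb_traj \<phi> F u x0 t) \<le> V (X i)"
proof -
  obtain i where i: "\<tau> i \<le> t" "t < \<tau> (Suc i)"
    "hyb_traj \<phi> F u x0 t = X i + (t - \<tau> i) *\<^sub>R F (h i) (X i)"
    using hyb_traj_in_step[OF assms] .
  show thesis
  proof (rule that[OF i(1)])
    show "t < \<tau> i + 1"
      using i(2) h_le[of i] phi_le[of "X i"] by (simp add: \<tau>_Suc)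
    show "V (hyb_traj \<phi> F u x0 t) \<le> V (X i)"
      unfolding i(3) using i by (intro V_step_le h_pos h_le) (auto simp: \<tau>_Suc)
  qed
qed

lemma norm_hyb_traj_le: "0 \<le> t \<Longrightarrow> norm (hyb_traj \<phi> F u x0 t) \<le> V x0"
  using V_hyb_traj_le order_trans[OF norm_le_V order_trans[OF _ V_X_le]] by blast

text \<open>As long as \<open>V\<close> exceeds \<epsilon>, a step of length h lowers it by at least
  c \<epsilon> h, and the step lengths add up to the grid time. Once at most \<epsilon>, it stays so
  by monotonicity.\<close>

lemma V_X_decrease:
  assumes "0 < \<epsilon>"
  shows "V (X i) \<le> max \<epsilon> (V x0 - c * \<epsilon> * \<tau> i)"
proof (induction i)
  case (Suc i)
  have le: "V (X (Suc i)) \<le> V (X i) - c * h i * V (X i)" "V (X (Suc i)) \<le> V (X i)"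
    using V_step[OF h_pos h_le less_imp_le[OF h_pos] order_refl, of i]
      V_step_le[OF h_pos h_le less_imp_le[OF h_pos] order_refl, of i]
    by (simp_all add: X_Suc algebra_simps)
  show ?case
  proof (cases "V (X i) \<le> \<epsilon>")
    case False
    then have "c * h i * \<epsilon> \<le> c * h i * V (X i)"
      using c_pos h_pos[of i] by (intro mult_left_mono) auto
    then show ?thesis
      using le Suc False by (simp add: \<tau>_Suc algebra_simps)
  qed (use le in auto)
qed simp

end

text \<open>Every bound on a trajectory involves \<open>u\<close> only through the elapsed time, and
  continuity of \<open>V\<close> bounds \<open>V x0\<close> in terms of \<open>norm x0\<close>;
  hence the uniformity.\<close>

lemma URGAS: "URGAS \<phi> F"
  unfolding URGAS_def
proof (intro conjI allI impI)
  fix x0 u t assume "locally_bounded_nonneg u"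
  then show "\<exists>i. t < fst (hyb_seq \<phi> F u x0 i)"
    by (rule \<tau>_unbounded)
next
  fix \<epsilon> :: real assume "0 < \<epsilon>"
  then obtain \<delta> where "0 < \<delta>" and \<delta>: "\<And>x. norm x < \<delta> \<Longrightarrow> V x < \<epsilon>"
    using cont_V[unfolded continuous_on_iff, rule_format, of 0 \<epsilon>] V_nonneg
    by (auto simp: V_0 dist_norm)
  show "\<exists>\<delta>>0. \<forall>x0 u t. locally_bounded_nonneg u \<and> norm x0 < \<delta> \<and> t \<ge> 0 \<longrightarrow>
         norm (hyb_traj \<phi> F u x0 t) < \<epsilon>"
    using \<open>0 < \<delta>\<close> le_less_trans[OF norm_hyb_traj_le \<delta>] by blast
next
  have V_bound: "\<exists>B. \<forall>x. norm x \<le> R \<longrightarrow> V x \<le> B" for R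
  proof -
    have "bdd_above (V ` cball 0 R)"
      by (intro bounded_imp_bdd_above compact_imp_bounded compact_continuous_image continuous_on_subset[OF cont_V]) auto
    then show ?thesis
      unfolding bdd_above_def by (metis image_eqI mem_cball_0)
  qed
  show "\<exists>B. \<forall>x0 u t. locally_bounded_nonneg u \<and> norm x0 \<le> R \<and> t \<ge> 0 \<longrightarrow>
         norm (hyb_traj \<phi> F u x0 t) \<le> B" for R
  proof -
    obtain B where "\<And>x. norm x \<le> R \<Longrightarrow> V x \<le> B"
      using V_bound by blast
    then show ?thesis
      using norm_hyb_traj_le order_trans by blast
  qed
  fix \<epsilon> R :: real assume "0 < \<epsilon>"
  obtain B where B: "\<And>x. norm x \<le> R \<Longrightarrow> V x \<le> B"
    using V_bound by blast
  \<comment> \<open>The summand 1 makes up for the last grid time, which may lag behind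
    \<open>t\<close> by almost one step of length 1.\<close>
  define T where "T = max 0 (B / (c * \<epsilon>) + 1)"
  have "norm (hyb_traj \<phi> F u x0 t) \<le> \<epsilon>"
    if u: "locally_bounded_nonneg u" and x0: "norm x0 \<le> R" and t: "T \<le> t" for x0 u t
  proof -
    obtain i where i: "t < fst (hyb_seq \<phi> F u x0 i) + 1"
      "V (hyb_traj \<phi> F u x0 t) \<le> V (snd (hyb_seq \<phi> F u x0 i))"
      using V_hyb_traj_le[OF u, of t] t by (auto simp: T_def)
    have "B / (c * \<epsilon>) < fst (hyb_seq \<phi> F u x0 i)"
      using i(1) t by (simp add: T_def)
    then have "V x0 - c * \<epsilon> * fst (hyb_seq \<phi> F u x0 i) < 0"
      using B[OF x0] c_pos \<open>0 < \<epsilon>\<close> by (simp add: divide_less_eq mult_ac)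
    then have "V (hyb_traj \<phi> F u x0 t) \<le> \<epsilon>"
      using V_X_decrease[OF u \<open>0 < \<epsilon>\<close>, of x0 i] i(2) V_nonneg[of "hyb_traj \<phi> F u x0 t"] \<open>0 < \<epsilon>\<close>
      by (auto simp: max_def split: if_splits)
    then show ?thesis
      using norm_le_V order_trans by blast
  qed
  then show "\<exists>T. \<forall>x0 u t. locally_bounded_nonneg u \<and> norm x0 \<le> R \<and> t \<ge> T \<longrightarrow>
         norm (hyb_traj \<phi> F u x0 t) \<le> \<epsilon>"
    by blast
qed

end

section \<open>The Runge--Kutta scheme\<close>

text \<open>The total stage deviation \<open>m\<close> is controlled along the branch from step size
  0, first by 1 and then by a multiple of \<open>h * norm x\<close>. Since the weights sum to 1, the
  error is a weighted sum of the differences \<open>f (Y i) - f x\<close>.\<close>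

lemma (in complete_field) RK_consistency_error:
  assumes b: "RK_consistent b s"
  obtains e C where "0 < e"
    "\<forall>x h Y. dist x x0 < e \<and> 0 < h \<and> h < e \<and> RK_reach a s f h x Y \<longrightarrow>
       norm ((\<Sum>i<s. b i *\<^sub>R f (Y i)) - f x) \<le> C * h * norm x"
proof -
  \<comment> \<open>One unit of room for \<open>x\<close> around \<open>x0\<close> and one more for
    the stages around \<open>x\<close>.\<close>
  define R where "R = norm x0 + 2"
  obtain L where L: "L-lipschitz_on (cball 0 R) f"
    using lipschitz by blast
  then have "0 \<le> L"
    by (rule lipschitz_on_nonneg)
  define A where "A = (\<Sum>i<s. \<Sum>j<s. \<bar>a i j\<bar>)"
  have "0 \<le> A"
    by (simp add: A_def sum_nonneg)
  \<comment> \<open>This makes \<open>h * A * L * R\<close> at most 1/2; the added 1 avoids division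
    by zero.\<close>
  define e where "e = min 1 (1 / (2 * (A * L * R + 1)))"
  define C where "C = (\<Sum>i<s. \<bar>b i\<bar>) * (L * (2 * (A * L)))"
  have "0 < R"
    using norm_ge_zero[of x0] unfolding R_def by linarith
  then have ALR: "0 \<le> A * L * R"
    using \<open>0 \<le> A\<close> \<open>0 \<le> L\<close> by simp
  have "0 < e"
    using ALR by (simp add: e_def)
  have "norm ((\<Sum>i<s. b i *\<^sub>R f (Y i)) - f x) \<le> C * h * norm x"
    if x: "dist x x0 < e" and h: "0 < h" "h < e" and Y: "RK_reach a s f h x Y" for x h Y
  proof -
    have norm_x: "norm x \<le> R - 1"
      using x norm_triangle_ineq2[of x x0] by (simp add: e_def R_def dist_norm)
    have hALR: "t * (A * L) * R \<le> 1 / 2" if "0 \<le> t" "t \<le> h" for t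
    proof -
      have "t * (A * L * R) \<le> 1 / (2 * (A * L * R + 1)) * (A * L * R)"
        using that h ALR by (intro mult_right_mono) (auto simp: e_def)
      also have "\<dots> \<le> 1 / 2"
        using ALR by (simp add: divide_simps)
      finally show ?thesis by (simp add: mult.assoc)
    qed
    obtain g where g: "\<forall>i<s. continuous_on {0..h} (\<lambda>t. g t i)"
      "\<forall>t\<in>{0..h}. RK_stages a s f t x (g t)" "\<forall>i<s. g h i = Y i"
      using Y unfolding RK_reach_def by blast
    then have cont: "\<And>i. i < s \<Longrightarrow> continuous_on {0..h} (\<lambda>t. g t i)"
      and stages: "\<And>t. 0 \<le> t \<Longrightarrow> t \<le> h \<Longrightarrow> RK_stages a s f t x (g t)"
      and gY: "\<And>i. i < s \<Longrightarrow> g h i = Y i"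
      by auto
    define m where "m t = (\<Sum>i<s. norm (g t i - x))" for t
    have dev_le: "norm (g t i - x) \<le> m t" if "i < s" for t i
      using that member_le_sum[of i "{..<s}" "\<lambda>i. norm (g t i - x)"] by (simp add: m_def)
    have g_le: "norm (g t i) \<le> norm x + m t" if "i < s" for t i
      using dev_le[OF that, of t] norm_triangle_sub[of "g t i" x] by simp
    have m_le: "m t \<le> t * (A * L) * (norm x + m t)" if t: "0 \<le> t" "t \<le> h" and "m t \<le> 1" for t
    proof -
      have f_le: "norm (f (g t j)) \<le> L * (norm x + m t)" if "j < s" for j
      proof -
        have "norm (g t j) \<le> R"
          using g_le[OF that, of t] norm_x \<open>m t \<le> 1\<close> by linarith
        then have "norm (f (g t j)) \<le> L * norm (g t j)"
          using lipschitz_onD[OF L, of "g t j" 0] \<open>0 < R\<close> by (simp add: f_0)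
        then show ?thesis
          using mult_left_mono[OF g_le[OF that, of t] \<open>0 \<le> L\<close>] by linarith
      qed
      have "m t \<le> (\<Sum>i<s. t * (\<Sum>j<s. \<bar>a i j\<bar> * (L * (norm x + m t))))"
        unfolding m_def[of t]
      proof (rule sum_mono)
        fix i assume "i \<in> {..<s}"
        then have "norm (g t i - x) = t * norm (\<Sum>j<s. a i j *\<^sub>R f (g t j))"
          using stages[OF t] t by (simp add: RK_stages_def)
        also have "\<dots> \<le> t * (\<Sum>j<s. \<bar>a i j\<bar> * (L * (norm x + m t)))"
          using t f_le by (intro mult_left_mono order_trans[OF norm_sum sum_mono])
            (auto intro: mult_left_mono)
        finally show "norm (g t i - x)
            \<le> t * (\<Sum>j<s. \<bar>a i j\<bar> * (L * (norm x + (\<Sum>i<s. norm (g t i - x)))))"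
          unfolding m_def .
      qed
      also have "\<dots> = t * (A * (L * (norm x + m t)))"
        by (simp add: A_def sum_distrib_left sum_distrib_right)
      finally show ?thesis by (simp add: mult.assoc)
    qed
    \<comment> \<open>Continuity of the branch enters here: at step size 0 all stages equal
      \<open>x\<close>, and the deviation cannot cross 1 on the way to \<open>h\<close>.\<close>
    have "m h < 1"
    proof (rule continuation_bound[where d = m and T = h and t = h])
      show "continuous_on {0..h} m"
        unfolding m_def using cont by (intro continuous_intros) auto
      show "m 0 < 1"
        using stages[of 0] h by (simp add: m_def RK_stages_def)
      fix t assume t: "0 \<le> t" "t \<le> h" and le: "\<And>r. 0 \<le> r \<Longrightarrow> r \<le> t \<Longrightarrow> m r \<le> 1"
      have "m t \<le> t * (A * L) * (norm x + m t)"
        using le t by (intro m_le) auto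
      also have "\<dots> \<le> t * (A * L) * R"
        using le[of t] t norm_x \<open>0 \<le> A\<close> \<open>0 \<le> L\<close> by (intro mult_left_mono) auto
      finally show "m t < 1"
        using hALR[OF t] by linarith
    qed (use h in auto)
    have "h * (A * L) \<le> 1 / 2"
    proof -
      have "h * (A * L) * 1 \<le> h * (A * L) * R"
        using h \<open>0 \<le> A\<close> \<open>0 \<le> L\<close> by (intro mult_left_mono) (auto simp: R_def add_increasing)
      then show ?thesis
        using hALR[of h] h by linarith
    qed
    \<comment> \<open>Half of \<open>m h\<close> is absorbed on the left, leaving a bound by
      \<open>norm x\<close> alone.\<close>
    then have "h * (A * L) * m h \<le> 1 / 2 * m h"
      by (intro mult_right_mono) (auto simp: m_def sum_nonneg)
    then have m_h: "m h \<le> 2 * (A * L) * h * norm x"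
      using m_le[of h] h \<open>m h < 1\<close> by (simp add: algebra_simps)
    have f_diff: "norm (f (Y i) - f x) \<le> L * m h" if "i < s" for i
    proof -
      have "norm (Y i) \<le> R"
        using g_le[OF that, of h] gY[OF that] norm_x \<open>m h < 1\<close> by simp
      then have "norm (f (Y i) - f x) \<le> L * norm (Y i - x)"
        using lipschitz_onD[OF L, of "Y i" x] norm_x by (simp add: dist_norm)
      then show ?thesis
        using mult_left_mono[OF dev_le[OF that, of h] \<open>0 \<le> L\<close>] gY[OF that] by simp
    qed
    have "(\<Sum>i<s. b i *\<^sub>R f (Y i)) - f x = (\<Sum>i<s. b i *\<^sub>R (f (Y i) - f x))"
      using b by (simp add: RK_consistent_def scaleR_diff_right sum_subtractf
        scaleR_left.sum[symmetric])
    also have "norm \<dots> \<le> (\<Sum>i<s. \<bar>b i\<bar> * (L * m h))"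
      using f_diff by (intro order_trans[OF norm_sum sum_mono]) (auto intro: mult_left_mono)
    also have "\<dots> = (\<Sum>i<s. \<bar>b i\<bar>) * (L * m h)"
      by (simp add: sum_distrib_right)
    also have "\<dots> \<le> (\<Sum>i<s. \<bar>b i\<bar>) * (L * (2 * (A * L) * h * norm x))"
      using m_h \<open>0 \<le> L\<close> by (intro mult_left_mono) (auto simp: sum_nonneg)
    finally show ?thesis
      by (simp add: C_def mult_ac)
  qed
  with \<open>0 < e\<close> show thesis
    by (intro that[of e C]) blast+
qed

section \<open>The Lyapunov function\<close>

text \<open>The local decay rate is written \<open>2 * c\<close> so that the weight exp(c t) leaves
  a surplus decay of rate \<open>c\<close>.\<close>

locale exponentially_attracting = complete_field +
  fixes \<delta> M c :: real
  assumes \<delta>_pos: "0 < \<delta>" and c_pos: "0 < c"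
    and attractive: "\<And>x. (flow x \<longlongrightarrow> 0) at_top"
    and flow_decay: "\<And>x t. norm x < \<delta> \<Longrightarrow> 0 \<le> t \<Longrightarrow>
      norm (flow x t) \<le> M * exp (- (2 * c) * t) * norm x"
begin

definition weighted :: "'a \<Rightarrow> real \<Rightarrow> real" where
  "weighted x t = exp (c * t) * norm (flow x t)"

definition lyap :: "'a \<Rightarrow> real" where
  "lyap x = (SUP t\<in>{0..}. weighted x t)"

text \<open>Surplus decay of rate \<open>c\<close> outweighs the constant \<open>M\<close> after the
  waiting time \<open>ln (max 1 M) / c\<close>. The maximum keeps the logarithm nonnegative for
  every real \<open>M\<close>.\<close>

lemma weighted_tail:
  assumes "norm (flow x T) < \<delta>" "0 \<le> T" "T + ln (max 1 M) / c \<le> t"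
  shows "weighted x t \<le> weighted x T"
proof -
  let ?N = "norm (flow x T)"
  have "0 \<le> ln (max 1 M) / c"
    using c_pos by simp
  then have "T \<le> t"
    using assms(3) by linarith
  have "ln (max 1 M) \<le> c * (t - T)"
    using assms(3) c_pos by (simp add: field_simps)
  then have "exp (ln (max 1 M)) \<le> exp (c * (t - T))"
    by (simp only: exp_le_cancel_iff)
  then have "M \<le> exp (c * (t - T))"
    by (simp add: exp_ln)
  have "norm (flow x t) \<le> M * exp (- (2 * c) * (t - T)) * ?N"
    using flow_decay[OF assms(1), of "t - T"] flow_add[OF assms(2), of "t - T" x] \<open>T \<le> t\<close> by simp
  also have "\<dots> \<le> exp (c * (t - T)) * exp (- (2 * c) * (t - T)) * ?N"
    using \<open>M \<le> exp (c * (t - T))\<close> by (intro mult_right_mono) auto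
  also have "\<dots> = exp (- c * (t - T)) * ?N"
    by (simp add: exp_add[symmetric] algebra_simps)
  finally have "weighted x t \<le> exp (c * t) * (exp (- c * (t - T)) * ?N)"
    unfolding weighted_def by (intro mult_left_mono) auto
  also have "\<dots> = exp (c * t + - c * (t - T)) * ?N"
    by (simp only: exp_add mult.assoc)
  also have "\<dots> = weighted x T"
    by (simp add: weighted_def algebra_simps)
  finally show ?thesis .
qed

text \<open>Near a point the supremum is attained on a fixed compact time interval, because all nearby
  solutions enter the ball of exponential decay at a common time and the weight grows at only
  half the decay rate.\<close>
lemma lyap_near:
  obtains e K where "0 < e" "0 \<le> K"
    "\<And>x. dist x x0 < e \<Longrightarrow> bdd_above (weighted x ` {0..})"
    "\<And>x y. dist x x0 < e \<Longrightarrow> dist y x0 < e \<Longrightarrow> lyap x \<le> lyap y + K * dist x y"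
proof -
  have "eventually (\<lambda>t. norm (flow x0 t) < \<delta> / 2) at_top"
    using \<delta>_pos by (intro order_tendstoD(2)[OF tendsto_norm_zero[OF attractive]]) simp
  then obtain T1 where T1: "\<And>t. T1 \<le> t \<Longrightarrow> norm (flow x0 t) < \<delta> / 2"
    by (auto simp: eventually_at_top_linorder)
  define T where "T = max 0 T1"
  define S where "S = T + ln (max 1 M) / c"
  have T: "0 \<le> T" "norm (flow x0 T) < \<delta> / 2" "T \<le> S"
    using T1[of T] c_pos by (auto simp: T_def S_def)
  obtain e1 B L where e1: "0 < e1" "0 \<le> L"
    and B: "\<And>x t. dist x x0 < e1 \<Longrightarrow> 0 \<le> t \<Longrightarrow> t \<le> S \<Longrightarrow> norm (flow x t) \<le> B"
    and L: "\<And>x y t. dist x x0 < e1 \<Longrightarrow> dist y x0 < e1 \<Longrightarrow> 0 \<le> t \<Longrightarrow> t \<le> S \<Longrightarrow>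
       dist (flow x t) (flow y t) \<le> exp (L * t) * dist x y"
    using flow_lipschitz_near[of S x0] T order_trans[OF T(1,3)] by metis
  \<comment> \<open>After growth by exp(L T) the distance is still below \<delta>/2 at time
    \<open>T\<close>, so solutions starting within \<open>e\<close> have norm below \<delta>
    there.\<close>
  define e where "e = min e1 (\<delta> / 2 * exp (- (L * T)))"
  have "0 < e"
    using e1 \<delta>_pos by (simp add: e_def)
  have reduce: "\<exists>r\<ge>0. r \<le> S \<and> weighted x t \<le> weighted x r" if x: "dist x x0 < e" and "0 \<le> t" for x t
  proof (cases "t \<le> S")
    case False
    have "norm (flow x T) \<le> norm (flow x0 T) + dist (flow x T) (flow x0 T)"
      by (simp add: dist_norm norm_triangle_sub)
    moreover have "dist (flow x T) (flow x0 T) \<le> exp (L * T) * dist x x0"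
      using x T e1 by (intro L) (auto simp: e_def)
    moreover have "exp (L * T) * dist x x0 < exp (L * T) * (\<delta> / 2 * exp (- (L * T)))"
      using x by (intro mult_strict_left_mono) (auto simp: e_def)
    moreover have "exp (L * T) * (\<delta> / 2 * exp (- (L * T))) = \<delta> / 2"
      by (simp add: exp_minus)
    ultimately have "norm (flow x T) < \<delta>"
      using T(2) by linarith
    then have "weighted x t \<le> weighted x T"
      using T False by (intro weighted_tail) (auto simp: S_def)
    then show ?thesis
      using T by blast
  qed (use \<open>0 \<le> t\<close> in auto)
  have weight_le: "exp (c * r) \<le> exp (c * S)" if "r \<le> S" for r
    using that c_pos by simp
  have bdd: "bdd_above (weighted x ` {0..})" if x: "dist x x0 < e" for x
  proof (rule bdd_aboveI2)
    fix t :: real assume "t \<in> {0..}"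
    then obtain r where r: "0 \<le> r" "r \<le> S" "weighted x t \<le> weighted x r"
      using reduce[OF x] by auto
    have "weighted x r \<le> exp (c * S) * B"
      unfolding weighted_def using r x weight_le by (intro mult_mono B) (auto simp: e_def)
    then show "weighted x t \<le> exp (c * S) * B"
      using r by linarith
  qed
  define K where "K = exp (c * S) * exp (L * S)"
  have "lyap x \<le> lyap y + K * dist x y" if x: "dist x x0 < e" and y: "dist y x0 < e" for x y
    unfolding lyap_def[of x]
  proof (rule cSUP_least)
    fix t :: real assume "t \<in> {0..}"
    then obtain r where r: "0 \<le> r" "r \<le> S" "weighted x t \<le> weighted x r"
      using reduce[OF x] by auto
    have "norm (flow x r) \<le> norm (flow y r) + dist (flow x r) (flow y r)"
      by (simp add: dist_norm norm_triangle_sub)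
    also have "dist (flow x r) (flow y r) \<le> exp (L * r) * dist x y"
      using r x y by (intro L) (auto simp: e_def)
    finally have "weighted x r \<le> weighted y r + exp (c * r) * (exp (L * r) * dist x y)"
      unfolding weighted_def distrib_left[symmetric] by simp
    moreover have "exp (c * r) * (exp (L * r) * dist x y) \<le> K * dist x y"
      unfolding K_def mult.assoc using r e1 weight_le by (intro mult_mono) (auto intro: mult_left_mono)
    moreover have "weighted y r \<le> lyap y"
      unfolding lyap_def using r bdd[OF y] by (intro cSUP_upper) auto
    ultimately show "weighted x t \<le> lyap y + K * dist x y"
      using r by linarith
  qed auto
  with \<open>0 < e\<close> bdd show thesis
    by (intro that[of e K]) (auto simp: K_def)
qed

lemma weighted_le_lyap: "0 \<le> t \<Longrightarrow> weighted x t \<le> lyap x"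
  unfolding lyap_def using lyap_near[of x] by (intro cSUP_upper) (auto, metis dist_self)

lemma norm_le_lyap: "norm x \<le> lyap x"
  using weighted_le_lyap[of 0 x] by (simp add: weighted_def)

lemma lyap_zero: "lyap 0 = 0"
proof -
  have "weighted 0 ` {0..} = {0}"
    by (force simp: weighted_def flow_zero)
  then show ?thesis
    by (simp add: lyap_def)
qed

text \<open>By the semigroup law, the weighted values along \<open>flow x r\<close> are exp(-c r)
  times those of \<open>x\<close> at times from \<open>r\<close> on, and these are bounded by the
  full supremum.\<close>

lemma lyap_flow:
  assumes "0 \<le> r"
  shows "lyap (flow x r) \<le> exp (- (c * r)) * lyap x"
  unfolding lyap_def[of "flow x r"]
proof (rule cSUP_least)
  fix t :: real assume "t \<in> {0..}"
  then have "weighted (flow x r) t = exp (- (c * r)) * weighted x (r + t)"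
    using assms by (simp add: weighted_def flow_add distrib_left exp_add exp_minus)
  also have "\<dots> \<le> exp (- (c * r)) * lyap x"
    using \<open>t \<in> {0..}\<close> assms by (intro mult_left_mono weighted_le_lyap) auto
  finally show "weighted (flow x r) t \<le> exp (- (c * r)) * lyap x" .
qed auto

lemma continuous_lyap: "continuous_on UNIV lyap"
  unfolding continuous_on_eq_continuous_within
proof
  fix x0
  obtain e K where e: "0 < e" "0 \<le> K"
    and K: "\<And>x y. dist x x0 < e \<Longrightarrow> dist y x0 < e \<Longrightarrow> lyap x \<le> lyap y + K * dist x y"
    using lyap_near[of x0] by metis
  have "K-lipschitz_on (ball x0 e) lyap"
  proof (rule lipschitz_onI)
    fix x y assume "x \<in> ball x0 e" "y \<in> ball x0 e"
    then show "dist (lyap x) (lyap y) \<le> K * dist x y"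
      using K[of x y] K[of y x] by (simp add: dist_commute dist_real_def abs_le_iff)
  qed (rule e)
  then have "continuous_on (ball x0 e) lyap"
    by (rule lipschitz_on_continuous_on)
  then show "continuous (at x0) lyap"
    using e by (simp add: continuous_on_eq_continuous_at)
qed

text \<open>The numerical point differs from \<open>flow x \<sigma>\<close> by at most
  \<open>D * \<sigma> * h * norm x\<close>. The local Lipschitz constant \<open>K\<close> and
  \<open>norm x \<le> lyap x\<close> turn this into a small multiple of
  \<open>\<sigma> * lyap x\<close>, to be set against the decay along the flow.\<close>

lemma lyap_step:
  assumes "\<exists>e>0. \<exists>C. \<forall>x h. dist x x0 < e \<and> 0 < h \<and> h < e \<longrightarrow> norm (F h x - f x) \<le> C * h * norm x"
  obtains e where "0 < e"
    "\<And>x h \<sigma>. dist x x0 < e \<Longrightarrow> 0 < h \<Longrightarrow> h < e \<Longrightarrow> 0 \<le> \<sigma> \<Longrightarrow> \<sigma> \<le> h \<Longrightarrow>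
      lyap (x + \<sigma> *\<^sub>R F h x) \<le> (1 - c / 2 * \<sigma>) * lyap x"
proof -
  obtain e1 C1 where e1: "0 < e1"
    and F: "\<And>x h. dist x x0 < e1 \<Longrightarrow> 0 < h \<Longrightarrow> h < e1 \<Longrightarrow> norm (F h x - f x) \<le> C1 * h * norm x"
    using assms by blast
  obtain e2 C2 where e2: "0 < e2" "0 \<le> C2"
    and euler: "\<And>x t. dist x x0 < e2 \<Longrightarrow> 0 \<le> t \<Longrightarrow> t \<le> 1 \<Longrightarrow>
       norm (flow x t - x - t *\<^sub>R f x) \<le> C2 * t^2 * norm x"
    and flow_near: "\<And>x t. dist x x0 < e2 \<Longrightarrow> 0 \<le> t \<Longrightarrow> t \<le> 1 \<Longrightarrow> norm (flow x t - x) \<le> C2 * t * norm x"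
    using flow_euler_error[of x0] by metis
  obtain e3 K where e3: "0 < e3" "0 \<le> K"
    and K: "\<And>x y. dist x x0 < e3 \<Longrightarrow> dist y x0 < e3 \<Longrightarrow> lyap x \<le> lyap y + K * dist x y"
    using lyap_near[of x0] by metis
  define D where "D = C2 + max 0 C1"
  define N where "N = norm x0 + 1"
  have D: "0 \<le> D" "C2 \<le> D"
    using e2 by (auto simp: D_def)
  have "0 \<le> N"
    by (simp add: N_def)
  \<comment> \<open>The first three entries secure the local estimates, the next two keep all points
    within \<open>e3\<close> of \<open>x0\<close>. The last two give decay at least 3/4 of the rate
    \<open>c\<close> and an error of at most 1/4, leaving 1/2.\<close>
  define e where "e = Min {1, e1, e2, e3 / 3, e3 / (3 * (D * N + 1)), 1 / (3 * c), c / (4 * (K * D + 1))}"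
  have "0 < D * N + 1" "0 < K * D + 1"
    using D \<open>0 \<le> N\<close> e3 by (auto intro: add_nonneg_pos)
  then have "0 < e"
    unfolding e_def using e1 e2 e3 c_pos by (subst Min_gr_iff) auto
  have e_le: "e \<le> 1" "e \<le> e1" "e \<le> e2" "e \<le> e3 / 3" "e \<le> e3 / (3 * (D * N + 1))"
      "e \<le> 1 / (3 * c)" "e \<le> c / (4 * (K * D + 1))"
    unfolding e_def by (rule Min_le, simp, blast)+
  have "lyap (x + \<sigma> *\<^sub>R F h x) \<le> (1 - c / 2 * \<sigma>) * lyap x"
    if x: "dist x x0 < e" and h: "0 < h" "h < e" and \<sigma>: "0 \<le> \<sigma>" "\<sigma> \<le> h" for x h \<sigma>
  proof -
    let ?y = "x + \<sigma> *\<^sub>R F h x" and ?z = "flow x \<sigma>"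
    have "norm x \<le> N"
      using x e_le(1) norm_triangle_ineq2[of x x0] by (simp add: N_def dist_norm)
    have hDN: "D * h * N < e3 / 3"
    proof -
      have "h < e3 / (3 * (D * N + 1))"
        using h(2) e_le(5) by linarith
      then have "h * (D * N + 1) < e3 / 3"
        using \<open>0 < D * N + 1\<close> by (simp add: less_divide_eq algebra_simps)
      then show ?thesis
        using h(1) by (simp add: algebra_simps)
    qed
    have "h \<le> 1"
      using h e_le(1) by linarith
    have "norm (?z - ?y) \<le> norm (?z - x - \<sigma> *\<^sub>R f x) + norm (\<sigma> *\<^sub>R (F h x - f x))"
      using norm_triangle_ineq4[of "?z - x - \<sigma> *\<^sub>R f x" "\<sigma> *\<^sub>R (F h x - f x)"]
      by (simp add: algebra_simps)
    also have "norm (?z - x - \<sigma> *\<^sub>R f x) \<le> C2 * \<sigma>^2 * norm x"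
      using x \<sigma> \<open>h \<le> 1\<close> e_le by (intro euler) auto
    also have "\<dots> \<le> C2 * (\<sigma> * h) * norm x"
      using \<sigma> e2 by (auto simp: power2_eq_square intro!: mult_right_mono mult_left_mono)
    also have "norm (\<sigma> *\<^sub>R (F h x - f x)) \<le> \<sigma> * (C1 * h * norm x)"
      using \<sigma> F[of x h] x h e_le by (auto intro: mult_left_mono)
    also have "\<dots> \<le> \<sigma> * (max 0 C1 * h * norm x)"
      using \<sigma> h by (intro mult_left_mono mult_right_mono) auto
    finally have zy: "dist ?y ?z \<le> D * \<sigma> * h * norm x"
      by (simp add: D_def algebra_simps dist_norm norm_minus_commute)
    have "D * \<sigma> * h * norm x \<le> D * 1 * h * N"
      using D \<sigma> h \<open>h \<le> 1\<close> \<open>norm x \<le> N\<close> by (intro mult_mono) auto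
    then have "dist ?y ?z < e3 / 3"
      using zy hDN by simp
    moreover have "dist ?z x < e3 / 3"
    proof -
      have "norm (?z - x) \<le> C2 * \<sigma> * norm x"
        using x \<sigma> \<open>h \<le> 1\<close> e_le by (intro flow_near) auto
      also have "\<dots> \<le> D * h * N"
        using D \<sigma> e2 \<open>norm x \<le> N\<close> by (intro mult_mono) auto
      finally show ?thesis
        using hDN by (simp add: dist_norm)
    qed
    ultimately have near: "dist ?y x0 < e3" "dist ?z x0 < e3"
      using dist_triangle[of ?z x0 x] dist_triangle[of ?y x0 ?z] x e_le(4) e3(1) by linarith+
    have "lyap ?y \<le> lyap ?z + K * dist ?y ?z"
      by (rule K[OF near])
    also have "lyap ?z \<le> exp (- (c * \<sigma>)) * lyap x"
      by (rule lyap_flow[OF \<sigma>(1)])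
    also have "K * dist ?y ?z \<le> K * (D * \<sigma> * h * lyap x)"
      using e3 D \<sigma> h
      by (intro mult_left_mono order_trans[OF zy] norm_le_lyap mult_nonneg_nonneg) auto
    finally have y: "lyap ?y \<le> (exp (- (c * \<sigma>)) + K * D * h * \<sigma>) * lyap x"
      by (simp add: algebra_simps)
    have "exp (- (c * \<sigma>)) \<le> 1 - 3 / 4 * (c * \<sigma>)"
    proof -
      let ?u = "c * \<sigma>"
      have u: "0 \<le> ?u" "?u \<le> 1 / 3"
      proof -
        have "\<sigma> \<le> 1 / (3 * c)"
          using \<sigma> h e_le(6) by linarith
        then show "?u \<le> 1 / 3" "0 \<le> ?u"
          using c_pos \<sigma> by (auto simp: field_simps)
      qed
      \<comment> \<open>The product is 1 + u/4 - 3 u^2/4, which is at least 1 exactly because 0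
        \<le> u \<le> 1/3.\<close>
      have "1 \<le> (1 - 3 / 4 * ?u) * (1 + ?u)"
        using mult_left_mono[OF u(2,1)] by (simp add: algebra_simps)
      also have "\<dots> \<le> (1 - 3 / 4 * ?u) * exp ?u"
        using u by (intro mult_left_mono exp_ge_add_one_self) auto
      finally show ?thesis
        by (simp add: exp_minus field_simps)
    qed
    moreover have "K * D * h * \<sigma> \<le> c / 4 * \<sigma>"
    proof (rule mult_right_mono)
      have "h \<le> c / (4 * (K * D + 1))"
        using h(2) e_le(7) by linarith
      then have "h * (4 * (K * D + 1)) \<le> c"
        using \<open>0 < K * D + 1\<close> by (simp add: le_divide_eq)
      then show "K * D * h \<le> c / 4"
        using h(1) by (simp add: algebra_simps)
    qed (rule \<sigma>)
    ultimately have "exp (- (c * \<sigma>)) + K * D * h * \<sigma> \<le> 1 - c / 2 * \<sigma>"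
      by (simp add: algebra_simps)
    then show ?thesis
      using y mult_right_mono[OF _ order_trans[OF norm_ge_zero norm_le_lyap]] order_trans by blast
  qed
  with \<open>0 < e\<close> show thesis
    by (rule that)
qed

end

section \<open>Choice of the step bound and conclusion\<close>

theorem theorem4p12:
  fixes f :: "real ^ 'n \<Rightarrow> real ^ 'n"
    and a :: "nat \<Rightarrow> nat \<Rightarrow> real" and b :: "nat \<Rightarrow> real" and s p :: nat
  assumes "p \<ge> 1"
    and "Ck p f"
    and "f 0 = 0"
    and "GAS f"
    and "LES f"
    and "RK_consistent b s"
    and "RK_order a b s f p"
  shows "\<exists>r>0. \<exists>\<phi> :: real ^ 'n \<Rightarrow> real.
           continuous_on UNIV \<phi> \<and> (\<forall>x. 0 < \<phi> x \<and> \<phi> x \<le> r) \<and>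
           (\<forall>x h. 0 \<le> h \<and> h \<le> \<phi> x \<longrightarrow> RK_unique a s f h x) \<and>
           URGAS \<phi> (RK_F a b s f)"
proof -
  interpret complete_field f
  proof
    show "\<exists>L. L-lipschitz_on (cball 0 R) f" for R
      using Ck_imp_lipschitz_on_cball[OF assms(2,1)] by blast
  qed (use assms(3,4) in \<open>auto simp: GAS_def\<close>)
  obtain \<delta> M c where les: "0 < \<delta>" "0 < c" "\<And>z t. is_sol f z \<Longrightarrow> norm (z 0) < \<delta> \<Longrightarrow> 0 \<le> t \<Longrightarrow>
      norm (z t) \<le> M * exp (- c * t) * norm (z 0)"
    using assms(5) unfolding LES_def by metis
  \<comment> \<open>The weight uses half of the given rate \<open>c\<close>;
    \<open>lyap_step\<close> halves it again, whence the \<open>c / 4\<close> below.\<close>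
  interpret exponentially_attracting f \<delta> M "c / 2"
  proof
    show "(flow x \<longlongrightarrow> 0) at_top" for x
      using assms(4) is_sol_flow[of x] by (simp add: GAS_def)
    show "norm (flow x t) \<le> M * exp (- (2 * (c / 2)) * t) * norm x" if "norm x < \<delta>" "0 \<le> t" for x t
      using les(3)[OF is_sol_flow, of x t] that by simp
  qed (use les in auto)
  let ?F = "RK_F a b s f"
  \<comment> \<open>Solvability of the stages and decrease at all partial steps are bundled, so that
    one continuous bound serves both.\<close>
  define P where "P x h \<longleftrightarrow> RK_unique a s f h x \<and> (\<forall>\<sigma>. 0 \<le> \<sigma> \<and> \<sigma> \<le> h \<longrightarrow>
    lyap (x + \<sigma> *\<^sub>R ?F h x) \<le> (1 - c / 4 * \<sigma>) * lyap x)" for x h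
  have "\<exists>e>0. \<forall>x h. dist x x0 < e \<and> 0 < h \<and> h < e \<longrightarrow> P x h" for x0
  proof -
    \<comment> \<open>The order condition on the compact unit ball supplies a uniform range of steps
      with unique stages.\<close>
    obtain h1 where h1: "0 < h1" "\<And>x h. x \<in> cball x0 1 \<Longrightarrow> 0 < h \<Longrightarrow> h \<le> h1 \<Longrightarrow> RK_unique a s f h x"
      using assms(7) compact_cball[of x0 1] unfolding RK_order_def by metis
    obtain e1 C where e1: "0 < e1"
      and C: "\<forall>x h Y. dist x x0 < e1 \<and> 0 < h \<and> h < e1 \<and> RK_reach a s f h x Y \<longrightarrow>
        norm ((\<Sum>i<s. b i *\<^sub>R f (Y i)) - f x) \<le> C * h * norm x"
      using RK_consistency_error[OF assms(6), of x0 a] .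
    define e2 where "e2 = min (min 1 h1) e1"
    have unique: "RK_unique a s f h x" if "dist x x0 < e2" "0 < h" "h < e2" for x h
      using that by (intro h1) (auto simp: e2_def dist_commute)
    have "norm (?F h x - f x) \<le> C * h * norm x" if "dist x x0 < e2" "0 < h" "h < e2" for x h
    proof -
      have "RK_reach a s f h x (SOME Y. RK_reach a s f h x Y)"
        using unique[OF that] by (intro someI_ex[of "RK_reach a s f h x"]) (simp add: RK_unique_def)
      then show ?thesis
        unfolding RK_F_def using that by (intro C[rule_format]) (auto simp: e2_def)
    qed
    moreover have "0 < e2"
      using h1 e1 by (simp add: e2_def)
    ultimately obtain e3 where e3: "0 < e3" "\<And>x h \<sigma>. dist x x0 < e3 \<Longrightarrow> 0 < h \<Longrightarrow> h < e3 \<Longrightarrow>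
        0 \<le> \<sigma> \<Longrightarrow> \<sigma> \<le> h \<Longrightarrow> lyap (x + \<sigma> *\<^sub>R ?F h x) \<le> (1 - c / 2 / 2 * \<sigma>) * lyap x"
      using lyap_step[of x0 ?F] by blast
    show ?thesis
      using \<open>0 < e2\<close> e3 unique by (intro exI[of _ "min e2 e3"]) (auto simp: P_def)
  qed
  then obtain \<phi> where \<phi>: "continuous_on UNIV \<phi>" "\<And>x. 0 < \<phi> x" "\<And>x. \<phi> x \<le> 1"
    and P: "\<And>x h. 0 < h \<Longrightarrow> h \<le> \<phi> x \<Longrightarrow> P x h"
    using continuous_step_bound[of P] by blast
  interpret hybrid_lyapunov \<phi> lyap ?F "c / 4"
    using \<phi> P les continuous_lyap lyap_zero norm_le_lyap
    by unfold_locales (auto simp: P_def)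
  \<comment> \<open>\<open>P\<close> speaks of positive steps only; at step size 0 every stage
    equals \<open>x\<close>.\<close>
  have "RK_unique a s f 0 x" for x
    unfolding RK_unique_def RK_reach_def
    by (auto simp: RK_stages_def intro!: exI[of _ "\<lambda>_. x"] exI[of _ "\<lambda>_ _. x"])
  then have "RK_unique a s f h x" if "0 \<le> h" "h \<le> \<phi> x" for x h
    using that P[of h x] by (cases "h = 0") (auto simp: P_def)
  with \<phi> URGAS show ?thesis
    by (intro exI[of _ 1] conjI exI[of _ \<phi>]) auto
qed

end
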